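(* Let $n\ge 1$, let $X,Y$ be path-connected topological spaces and let $f=(f_1,\dots,f_n):X\to Y^n$ be a surjective fibration. Then $TC_n(f)\le TC_n(X)$.
   Context: For continuous maps $g_1,\dots,g_k:A\to B$, the higher homotopic distance $D(g_1,\dots,g_k)$ is the smallest positive integer $l$ such that $A$ has an open cover $U_1,\dots,U_l$ with $g_1|_{U_j}\simeq\cdots\simeq g_k|_{U_j}$ for every $j$; it is $\infty$ if there is no such cover. For a surjective fibration $f=(f_1,\dots,f_n):X\to Y^n$ with $n>1$, $TC_n(f)=D(f\circ p_1,\dots,f\circ p_n)$, where $p_i:X^n\to X$ is the projection onto the $i$-th factor; by convention $TC_1(f)=1$. For a fibration $g:A\to B$, $secat(g)$ is the smallest $l$ such that $B$ has an open cover $V_1,\dots,V_l$ with continuous maps $s_i:V_i\to A$ satisfying $g\circ s_i=1_{V_i}$ ($\infty$ if none exists). For path-connected $X$, $TC_n(X)=secat(e_n)$, where $J_n$ is the wedge of $n$ copies of $[0,1]$ glued at their initial points $0$, and $e_n:X^{J_n}\to X^n$, $e_n(\beta)=(\beta_1(1),\dots,\beta_n(1))$ with $\beta_i$ the restriction of $\beta$ to the $i$-th copy of $[0,1]$. *)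

theory Defs
  imports "HOL-Analysis.Analysis"
begin

section \<open>Quotient spaces and mapping spaces\<close>

definition quotient_topology :: "'a topology \<Rightarrow> ('a \<Rightarrow> 'b) \<Rightarrow> 'b topology" where
  "quotient_topology X q =
     topology (\<lambda>U. U \<subseteq> q ` topspace X \<and> openin X {x \<in> topspace X. q x \<in> U})"

lemma openin_quotient_topology:
  "openin (quotient_topology X q) U \<longleftrightarrow>
     U \<subseteq> q ` topspace X \<and> openin X {x \<in> topspace X. q x \<in> U}"
proof -
  have int: "{x \<in> topspace X. q x \<in> S \<inter> T} =
      {x \<in> topspace X. q x \<in> S} \<inter> {x \<in> topspace X. q x \<in> T}" for S T
    by auto
  have union: "{x \<in> topspace X. q x \<in> \<Union>\<K>} = (\<Union>K\<in>\<K>. {x \<in> topspace X. q x \<in> K})" for \<K>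
    by auto
  have "istopology (\<lambda>U. U \<subseteq> q ` topspace X \<and> openin X {x \<in> topspace X. q x \<in> U})"
    unfolding istopology_def int union by blast
  then show ?thesis
    by (simp add: quotient_topology_def)
qed

lemma topspace_quotient_topology [simp]:
  "topspace (quotient_topology X q) = q ` topspace X"
proof (rule antisym)
  show "topspace (quotient_topology X q) \<subseteq> q ` topspace X"
    using openin_topspace [of "quotient_topology X q"] unfolding openin_quotient_topology by simp
  have "{x \<in> topspace X. q x \<in> q ` topspace X} = topspace X"
    by auto
  then have "openin (quotient_topology X q) (q ` topspace X)"
    by (simp add: openin_quotient_topology)
  then show "q ` topspace X \<subseteq> topspace (quotient_topology X q)"
    by (rule openin_subset)
qed

lemma quotient_map_quotient_topology: "quotient_map X (quotient_topology X q) q"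
  by (simp add: quotient_map_def openin_quotient_topology)

text \<open>
  The space of continuous maps with the compact-open topology. Maps are taken to be
  extensional, so that they are determined by their values on the domain. The case of the
  empty compact set shows that the whole set of maps belongs to the subbasis.
\<close>

definition mapping_space :: "'a topology \<Rightarrow> 'b topology \<Rightarrow> ('a \<Rightarrow> 'b) topology" where
  "mapping_space K X = topology_generated_by
     {{h \<in> extensional (topspace K). continuous_map K X h \<and> h ` C \<subseteq> U} | C U.
        compactin K C \<and> openin X U}"

lemma topspace_mapping_space [simp]:
  "topspace (mapping_space K X) = {h \<in> extensional (topspace K). continuous_map K X h}"
proof -
  let ?S = "\<lambda>C U. {h \<in> extensional (topspace K). continuous_map K X h \<and> h ` C \<subseteq> U}"
  have "?S {} {} \<in> {?S C U | C U. compactin K C \<and> openin X U}"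
    using compactin_empty openin_empty by blast
  moreover have "?S {} {} = {h \<in> extensional (topspace K). continuous_map K X h}"
    by simp
  ultimately have "\<Union> {?S C U | C U. compactin K C \<and> openin X U} =
      {h \<in> extensional (topspace K). continuous_map K X h}"
    by blast
  then show ?thesis
    unfolding mapping_space_def topology_generated_by_topspace .
qed

lemma continuous_map_curry:
  assumes "continuous_map (prod_topology Z K) X H"
  shows "continuous_map Z (mapping_space K X) (\<lambda>z. \<lambda>t\<in>topspace K. H (z, t))"
proof -
  have cont: "continuous_map K X (\<lambda>t\<in>topspace K. H (z, t))" if "z \<in> topspace Z" for z
  proof -
    have "continuous_map K (prod_topology Z K) (\<lambda>t. (z, t))"
      using that by (simp add: continuous_map_pairwise o_def)
    from continuous_map_compose [OF this assms] show ?thesis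
      by (rule continuous_map_eq) auto
  qed
  have pre: "openin Z {z \<in> topspace Z. (\<lambda>t\<in>topspace K. H (z, t)) ` C \<subseteq> U}"
    if C: "compactin K C" and U: "openin X U" for C U
  proof (subst openin_subopen, clarify)
    fix z assume z: "z \<in> topspace Z" and im: "(\<lambda>t\<in>topspace K. H (z, t)) ` C \<subseteq> U"
    let ?W = "{p \<in> topspace (prod_topology Z K). H p \<in> U}"
    have CK: "C \<subseteq> topspace K"
      using C by (rule compactin_subset_topspace)
    have W: "openin (prod_topology Z K) ?W"
      using assms U by (simp add: continuous_map)
    have zc: "compactin Z {z}"
      using z by simp
    have sub: "{z} \<times> C \<subseteq> ?W"
      using z im CK by auto
    obtain A B where AB: "openin Z A" "openin K B" "{z} \<subseteq> A" "C \<subseteq> B" "A \<times> B \<subseteq> ?W"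
      by (rule Wallace_theorem_prod_topology [OF zc C W sub])
    have "A \<subseteq> {z \<in> topspace Z. (\<lambda>t\<in>topspace K. H (z, t)) ` C \<subseteq> U}"
      using AB CK openin_subset [OF AB(1)] by auto
    then show "\<exists>T. openin Z T \<and> z \<in> T \<and>
        T \<subseteq> {z \<in> topspace Z. (\<lambda>t\<in>topspace K. H (z, t)) ` C \<subseteq> U}"
      using AB by blast
  qed
  show ?thesis
    unfolding mapping_space_def
  proof (rule continuous_on_generated_topo)
    fix V
    assume "V \<in> {{h \<in> extensional (topspace K). continuous_map K X h \<and> h ` C \<subseteq> U} | C U.
        compactin K C \<and> openin X U}"
    then obtain C U where V: "compactin K C" "openin X U"
      "V = {h \<in> extensional (topspace K). continuous_map K X h \<and> h ` C \<subseteq> U}"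
      by blast
    have "(\<lambda>z. \<lambda>t\<in>topspace K. H (z, t)) -` V \<inter> topspace Z =
        {z \<in> topspace Z. (\<lambda>t\<in>topspace K. H (z, t)) ` C \<subseteq> U}"
      unfolding V(3) using cont restrict_extensional by blast
    then show "openin Z ((\<lambda>z. \<lambda>t\<in>topspace K. H (z, t)) -` V \<inter> topspace Z)"
      using pre [OF V(1,2)] by simp
  next
    show "(\<lambda>z. \<lambda>t\<in>topspace K. H (z, t)) ` topspace Z \<subseteq>
        \<Union> {{h \<in> extensional (topspace K). continuous_map K X h \<and> h ` C \<subseteq> U} | C U.
             compactin K C \<and> openin X U}"
      unfolding topspace_mapping_space
          [unfolded mapping_space_def topology_generated_by_topspace]
      using cont restrict_extensional by blast
  qed
qed

lemma continuous_map_evaluation: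
  assumes "neighbourhood_base_of (compactin K) K"
  shows "continuous_map (prod_topology (mapping_space K X) K) X (\<lambda>(h, t). h t)"
  unfolding continuous_map
proof (intro conjI allI impI)
  show "(\<lambda>(h, t). h t) ` topspace (prod_topology (mapping_space K X) K) \<subseteq> topspace X"
    by (auto simp: continuous_map_def)
next
  fix U assume U: "openin X U"
  show "openin (prod_topology (mapping_space K X) K)
     {p \<in> topspace (prod_topology (mapping_space K X) K). (case p of (h, t) \<Rightarrow> h t) \<in> U}"
  proof (subst openin_subopen, clarify)
    fix h t
    assume ht: "(h, t) \<in> topspace (prod_topology (mapping_space K X) K)" and hU: "h t \<in> U"
    then have h: "h \<in> extensional (topspace K)" "continuous_map K X h" and t: "t \<in> topspace K"
      by auto
    have "openin K {s \<in> topspace K. h s \<in> U}"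
      using h U by (simp add: continuous_map)
    then obtain A C where AC: "openin K A" "compactin K C" "t \<in> A" "A \<subseteq> C"
      "C \<subseteq> {s \<in> topspace K. h s \<in> U}"
      using assms t hU unfolding neighbourhood_base_of
      by (metis (no_types, lifting) mem_Collect_eq)
    let ?N = "{h \<in> extensional (topspace K). continuous_map K X h \<and> h ` C \<subseteq> U}"
    have "openin (mapping_space K X) ?N"
      unfolding mapping_space_def using AC(2) U by (intro topology_generated_by_Basis) blast
    then have "openin (prod_topology (mapping_space K X) K) (?N \<times> A)"
      using AC by (simp add: openin_prod_Times_iff)
    moreover have "(h, t) \<in> ?N \<times> A"
      using h AC by auto
    moreover have "?N \<times> A \<subseteq> {p \<in> topspace (prod_topology (mapping_space K X) K).
        (case p of (h, t) \<Rightarrow> h t) \<in> U}"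
      using AC(4) openin_subset [OF AC(1)] by (auto simp: image_subset_iff subset_iff)
    ultimately show "\<exists>T. openin (prod_topology (mapping_space K X) K) T \<and> (h, t) \<in> T \<and>
        T \<subseteq> {p \<in> topspace (prod_topology (mapping_space K X) K). (case p of (h, t) \<Rightarrow> h t) \<in> U}"
      by blast
  qed
qed


section \<open>Hurewicz fibrations\<close>

abbreviation unit_interval :: "real topology" where
  "unit_interval \<equiv> top_of_set {0..1}"

definition homotopy_lifting_property ::
  "'z topology \<Rightarrow> 'e topology \<Rightarrow> 'b topology \<Rightarrow> ('e \<Rightarrow> 'b) \<Rightarrow> bool" where
  "homotopy_lifting_property Z E B p \<longleftrightarrow>
     (\<forall>H h. continuous_map (prod_topology Z unit_interval) B H \<and> continuous_map Z E h \<and>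
            (\<forall>z \<in> topspace Z. p (h z) = H (z, 0)) \<longrightarrow>
        (\<exists>H'. continuous_map (prod_topology Z unit_interval) E H' \<and>
              (\<forall>z \<in> topspace Z. H' (z, 0) = h z) \<and>
              (\<forall>z \<in> topspace Z. \<forall>t \<in> {0..1}. p (H' (z, t)) = H (z, t))))"

text \<open>
  A Hurewicz fibration has the homotopy lifting property for all spaces, but a definition
  cannot quantify over types. The quantifier below runs over all spaces on one type, which is
  large enough to carry the space of pairs of a point of \<open>E\<close> and a path in \<open>B\<close> starting at its
  image. Theorem \<open>fibration_lifting\<close> below shows that this gives the lifting property for
  spaces on every type.
\<close>

definition fibration :: "'e topology \<Rightarrow> 'b topology \<Rightarrow> ('e \<Rightarrow> 'b) \<Rightarrow> bool" where
  "fibration E B p \<longleftrightarrow> continuous_map E B p \<and>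
     (\<forall>Z :: ('e \<times> (real \<Rightarrow> 'b)) topology. homotopy_lifting_property Z E B p)"

lemma neighbourhood_base_unit_interval: "neighbourhood_base_of (compactin unit_interval) unit_interval"
proof -
  have "Hausdorff_space unit_interval"
    by (simp add: Hausdorff_space_subtopology)
  moreover have "compact_space unit_interval"
    by (simp add: compact_space_subtopology)
  ultimately show ?thesis
    using compact_imp_locally_compact_space locally_compact_space_neighbourhood_base by blast
qed

theorem fibration_lifting:
  fixes Z :: "'z topology"
  assumes "fibration E B p"
  shows "homotopy_lifting_property Z E B p"
  unfolding homotopy_lifting_property_def
proof (intro allI impI)
  fix H h
  assume a: "continuous_map (prod_topology Z unit_interval) B H \<and> continuous_map Z E h \<and>
            (\<forall>z \<in> topspace Z. p (h z) = H (z, 0))"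
  let ?M = "mapping_space unit_interval B"
  define P where "P = subtopology (prod_topology E ?M) {(x, w). p x = w 0}"
  let ?G = "\<lambda>((x, w), t). w t"
  have proj: "continuous_map (prod_topology P unit_interval) (prod_topology E ?M) fst"
    unfolding P_def
    by (metis continuous_map_fst continuous_map_in_subtopology)
  have "continuous_map (prod_topology P unit_interval) (prod_topology ?M unit_interval)
      (\<lambda>q. (snd (fst q), snd q))"
    using continuous_map_compose [OF proj continuous_map_snd]
    by (simp add: continuous_map_pairwise o_def continuous_map_snd)
  from continuous_map_compose [OF this continuous_map_evaluation [OF neighbourhood_base_unit_interval]]
  have G: "continuous_map (prod_topology P unit_interval) B ?G"
    by (simp add: o_def case_prod_unfold)
  have F: "continuous_map P E fst"
    unfolding P_def by (intro continuous_map_from_subtopology continuous_map_fst)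
  have start: "\<forall>z \<in> topspace P. p (fst z) = ?G (z, 0)"
    by (auto simp: P_def)
  have "homotopy_lifting_property P E B p"
    using assms by (simp add: fibration_def)
  from this [unfolded homotopy_lifting_property_def, rule_format, OF conjI [OF G conjI [OF F start]]]
  obtain L where L: "continuous_map (prod_topology P unit_interval) E L"
      "\<And>z. z \<in> topspace P \<Longrightarrow> L (z, 0) = fst z"
      "\<And>z t. \<lbrakk>z \<in> topspace P; t \<in> {0..1}\<rbrakk> \<Longrightarrow> p (L (z, t)) = ?G (z, t)"
    by blast
  define k where "k = (\<lambda>z. (h z, \<lambda>t\<in>topspace unit_interval. H (z, t)))"
  have "continuous_map Z (prod_topology E ?M) k"
    using a continuous_map_curry [of Z unit_interval B H]
    by (simp add: k_def continuous_map_pairwise o_def)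
  moreover have "k ` topspace Z \<subseteq> {(x, w). p x = w 0}"
    using a by (auto simp: k_def)
  ultimately have k: "continuous_map Z P k"
    by (auto simp: P_def continuous_map_in_subtopology)
  then have kP: "k z \<in> topspace P" if "z \<in> topspace Z" for z
    using that by (auto simp: continuous_map_def)
  have "continuous_map (prod_topology Z unit_interval) (prod_topology P unit_interval)
      (\<lambda>q. (k (fst q), snd q))"
    using continuous_map_compose [OF continuous_map_fst k]
    by (simp add: continuous_map_pairwise o_def continuous_map_snd)
  from continuous_map_compose [OF this L(1)]
  have "continuous_map (prod_topology Z unit_interval) E (\<lambda>q. L (k (fst q), snd q))"
    by (simp add: o_def)
  moreover have "\<forall>z \<in> topspace Z. L (k (fst (z, 0)), snd (z, 0::real)) = h z"
    using L(2) kP by (simp add: k_def)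
  moreover have "\<forall>z \<in> topspace Z. \<forall>t \<in> {0..1}. p (L (k (fst (z, t)), snd (z, t))) = H (z, t)"
    using L(3) kP by (simp add: k_def)
  ultimately show "\<exists>H'. continuous_map (prod_topology Z unit_interval) E H' \<and>
              (\<forall>z \<in> topspace Z. H' (z, 0) = h z) \<and>
              (\<forall>z \<in> topspace Z. \<forall>t \<in> {0..1}. p (H' (z, t)) = H (z, t))"
    by blast
qed


section \<open>Homotopic distance, sectional category and topological complexity\<close>

text \<open>
  Families of \<open>n\<close> objects are indexed by \<open>{..<n}\<close>. The infimum of the empty set in \<^typ>\<open>enat\<close>
  is \<open>\<infinity>\<close>. Both invariants are unnormalised: covers have at least one member, so each is at
  least 1.
\<close>

definition homotopic_distance ::
  "nat \<Rightarrow> 'a topology \<Rightarrow> 'b topology \<Rightarrow> (nat \<Rightarrow> 'a \<Rightarrow> 'b) \<Rightarrow> enat" where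
  "homotopic_distance k A B g = Inf {enat l | l. 0 < l \<and>
     (\<exists>U. (\<forall>j<l. openin A (U j)) \<and> (\<Union>j<l. U j) = topspace A \<and>
          (\<forall>j<l. \<forall>i. Suc i < k \<longrightarrow>
             homotopic_with (\<lambda>_. True) (subtopology A (U j)) B (g i) (g (Suc i))))}"

definition secat :: "'a topology \<Rightarrow> 'b topology \<Rightarrow> ('a \<Rightarrow> 'b) \<Rightarrow> enat" where
  "secat A B g = Inf {enat l | l. 0 < l \<and>
     (\<exists>V. (\<forall>j<l. openin B (V j)) \<and> (\<Union>j<l. V j) = topspace B \<and>
          (\<forall>j<l. \<exists>s. continuous_map (subtopology B (V j)) A s \<and> (\<forall>b \<in> V j. g (s b) = b)))}"

abbreviation power_topology :: "'a topology \<Rightarrow> nat \<Rightarrow> (nat \<Rightarrow> 'a) topology" where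
  "power_topology X n \<equiv> product_topology (\<lambda>_. X) {..<n}"

definition TC_map :: "nat \<Rightarrow> 'a topology \<Rightarrow> 'b topology \<Rightarrow> ('a \<Rightarrow> nat \<Rightarrow> 'b) \<Rightarrow> enat" where
  "TC_map n X Y f = (if n = 1 then 1
     else homotopic_distance n (power_topology X n) (power_topology Y n) (\<lambda>i. f \<circ> (\<lambda>x. x i)))"

text \<open>
  The point \<open>t\<close> of the \<open>i\<close>-th copy of the interval is sent to its class in the wedge. The
  initial points of all copies form one class, with representative \<open>(0, 0)\<close>; every other
  class is a singleton.
\<close>

definition wedge_point :: "nat \<times> real \<Rightarrow> nat \<times> real" where
  "wedge_point = (\<lambda>(i, t). if t = 0 then (0, 0) else (i, t))"

definition wedge_intervals :: "nat \<Rightarrow> (nat \<times> real) topology" where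
  "wedge_intervals n =
     quotient_topology (sum_topology (\<lambda>_. unit_interval) {..<n}) wedge_point"

definition wedge_restrict :: "(nat \<times> real \<Rightarrow> 'a) \<Rightarrow> nat \<Rightarrow> real \<Rightarrow> 'a" where
  "wedge_restrict \<beta> i t = \<beta> (wedge_point (i, t))"

definition wedge_evaluation :: "nat \<Rightarrow> (nat \<times> real \<Rightarrow> 'a) \<Rightarrow> nat \<Rightarrow> 'a" where
  "wedge_evaluation n \<beta> = (\<lambda>i\<in>{..<n}. wedge_restrict \<beta> i 1)"

definition TC :: "nat \<Rightarrow> 'a topology \<Rightarrow> enat" where
  "TC n X =
     secat (mapping_space (wedge_intervals n) X) (power_topology X n) (wedge_evaluation n)"

end

theory Submission
  imports Defs
begin

text \<open>
  A section of \<open>e\<^sub>n\<close> over \<open>V\<close> chooses, for each \<open>x\<close> in \<open>V\<close>, paths from a common point \<open>c x\<close> to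
  all the coordinates of \<open>x\<close>. Running the \<open>i\<close>-th path backwards deforms the \<open>i\<close>-th projection
  on \<open>V\<close> to \<open>c\<close>, so the projections are homotopic to each other on \<open>V\<close>, and so are their
  composites with \<open>f\<close>. Hence every cover admissible for \<open>TC\<^sub>n(X)\<close> is admissible for
  \<open>TC\<^sub>n(f)\<close>.
\<close>

lemma continuous_map_precompose:
  assumes "continuous_map L K \<phi>"
  shows "continuous_map (mapping_space K X) (mapping_space L X) (\<lambda>h. \<lambda>t\<in>topspace L. h (\<phi> t))"
proof -
  have maps: "(\<lambda>t\<in>topspace L. h (\<phi> t)) \<in> topspace (mapping_space L X)"
    if "h \<in> topspace (mapping_space K X)" for h
  proof -
    have "continuous_map L X (h \<circ> \<phi>)"
      using that assms by (auto intro: continuous_map_compose)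
    then have "continuous_map L X (\<lambda>t\<in>topspace L. h (\<phi> t))"
      by (rule continuous_map_eq) auto
    then show ?thesis
      by simp
  qed
  show ?thesis
    unfolding mapping_space_def [of L]
  proof (rule continuous_on_generated_topo)
    fix V
    assume "V \<in> {{h \<in> extensional (topspace L). continuous_map L X h \<and> h ` C \<subseteq> U} | C U.
        compactin L C \<and> openin X U}"
    then obtain C U where V: "compactin L C" "openin X U"
      "V = {h \<in> extensional (topspace L). continuous_map L X h \<and> h ` C \<subseteq> U}"
      by blast
    have CL: "C \<subseteq> topspace L"
      using V(1) by (rule compactin_subset_topspace)
    have "(\<lambda>h. \<lambda>t\<in>topspace L. h (\<phi> t)) -` V \<inter> topspace (mapping_space K X) =
        {h \<in> extensional (topspace K). continuous_map K X h \<and> h ` \<phi> ` C \<subseteq> U}"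
      using maps CL unfolding V(3) by (auto simp: image_subset_iff subset_iff)
    moreover have "compactin K (\<phi> ` C)"
      using V(1) assms by (rule image_compactin)
    then have "openin (mapping_space K X)
        {h \<in> extensional (topspace K). continuous_map K X h \<and> h ` \<phi> ` C \<subseteq> U}"
      unfolding mapping_space_def using V(2) by (intro topology_generated_by_Basis) blast
    ultimately show "openin (mapping_space K X)
        ((\<lambda>h. \<lambda>t\<in>topspace L. h (\<phi> t)) -` V \<inter> topspace (mapping_space K X))"
      by simp
  next
    show "(\<lambda>h. \<lambda>t\<in>topspace L. h (\<phi> t)) ` topspace (mapping_space K X) \<subseteq>
        \<Union> {{h \<in> extensional (topspace L). continuous_map L X h \<and> h ` C \<subseteq> U} | C U.
             compactin L C \<and> openin X U}"
      using maps
      unfolding mapping_space_def [of L] topology_generated_by_topspace by blast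
  qed
qed

lemma continuous_map_wedge_point:
  assumes "i < n"
  shows "continuous_map unit_interval (wedge_intervals n) (\<lambda>t. wedge_point (i, t))"
proof -
  have "continuous_map unit_interval (sum_topology (\<lambda>_. unit_interval) {..<n}) (Pair i)"
    using assms by (intro continuous_map_component_injection) simp
  from continuous_map_compose
    [OF this quotient_imp_continuous_map [OF quotient_map_quotient_topology]]
  show ?thesis
    by (simp add: wedge_intervals_def o_def)
qed

text \<open>The map factors through the path space of \<open>X\<close>: first restrict
  \<open>\<beta>\<close> to the \<open>i\<close>-th copy of the interval, then evaluate the
  resulting path. Joint continuity of evaluation thus rests on local compactness of the interval and
  not of the wedge.\<close>

lemma continuous_map_wedge_restrict:
  fixes X :: "'a topology"
  assumes "i < n"
  shows "continuous_map (prod_topology (mapping_space (wedge_intervals n) X) unit_interval) X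
           (\<lambda>(\<beta>, t). wedge_restrict \<beta> i t)"
proof -
  let ?M = "mapping_space (wedge_intervals n) X"
  \<comment> \<open>Cutting off outside the interval makes \<open>r \<beta>\<close> extensional,
    hence a point of the mapping space; on the interval it agrees with
    \<open>wedge_restrict \<beta> i\<close>.\<close>
  define r where "r = (\<lambda>\<beta> :: nat \<times> real \<Rightarrow> 'a. \<lambda>t\<in>topspace unit_interval. \<beta> (wedge_point (i, t)))"
  have "continuous_map ?M (mapping_space unit_interval X) r"
    unfolding r_def using assms by (intro continuous_map_precompose continuous_map_wedge_point)
  from continuous_map_compose [OF continuous_map_fst this]
  have "continuous_map (prod_topology ?M unit_interval) (mapping_space unit_interval X) (\<lambda>p. r (fst p))"
    by (simp add: o_def)
  then have "continuous_map (prod_topology ?M unit_interval)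
      (prod_topology (mapping_space unit_interval X) unit_interval) (\<lambda>p. (r (fst p), snd p))"
    by (rule continuous_map_pairedI) (rule continuous_map_snd)
  from continuous_map_compose
    [OF this continuous_map_evaluation [OF neighbourhood_base_unit_interval]]
  show ?thesis
    by (rule continuous_map_eq) (auto simp: r_def wedge_restrict_def)
qed

lemma homotopic_projection_base_point:
  assumes s: "continuous_map (subtopology (power_topology X n) V)
              (mapping_space (wedge_intervals n) X) s"
    and sec: "\<And>x. x \<in> V \<Longrightarrow> wedge_evaluation n (s x) = x"
    and i: "i < n"
  shows "homotopic_with (\<lambda>_. True) (subtopology (power_topology X n) V) X
           (\<lambda>x. x i) (\<lambda>x. s x (0, 0))"
proof -
  let ?A = "subtopology (power_topology X n) V"
  let ?M = "mapping_space (wedge_intervals n) X"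
  let ?h = "\<lambda>(t, x). wedge_restrict (s x) i (1 - t)"
  have "continuous_map unit_interval unit_interval (\<lambda>t. 1 - t)"
    by (auto intro!: continuous_intros)
  from continuous_map_compose [OF continuous_map_fst this]
    continuous_map_compose [OF continuous_map_snd s]
  have "continuous_map (prod_topology unit_interval ?A) (prod_topology ?M unit_interval)
      (\<lambda>p. (s (snd p), 1 - fst p))"
    unfolding o_def continuous_map_paired by (intro conjI)
  from continuous_map_compose [OF this continuous_map_wedge_restrict [OF i]]
  have "continuous_map (prod_topology unit_interval ?A) X ?h"
    by (simp add: o_def case_prod_unfold)
  moreover have "?h (0, x) = x i" if "x \<in> topspace ?A" for x
  proof -
    have "wedge_evaluation n (s x) i = x i"
      using sec that by simp
    then show ?thesis
      using i by (simp add: wedge_evaluation_def)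
  qed
  \<comment> \<open>At time 1 the path parameter is 0, and \<open>wedge_point\<close> sends
    \<open>(i, 0)\<close> to \<open>(0, 0)\<close> for every \<open>i\<close>, so the final map is
    the same for all projections.\<close>
  moreover have "?h (1, x) = s x (0, 0)" for x
    by (simp add: wedge_restrict_def wedge_point_def)
  ultimately show ?thesis
    by (subst homotopic_with) auto
qed

lemma homotopic_distance_projections_le_TC:
  assumes f: "continuous_map X Y f"
  shows "homotopic_distance n (power_topology X n) Y (\<lambda>i. f \<circ> (\<lambda>x. x i)) \<le> TC n X"
  unfolding homotopic_distance_def TC_def secat_def
\<comment> \<open>The infimum is antitone, so it suffices that each \<open>l\<close> admissible for
  \<open>secat\<close> is admissible for the distance; the same cover \<open>V\<close>
  serves.\<close>
proof (rule Inf_superset_mono, clarify)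
  fix l :: nat and V
  let ?P = "power_topology X n"
  assume l: "0 < l" and V: "\<forall>j<l. openin ?P (V j)" "(\<Union>j<l. V j) = topspace ?P"
    and s: "\<forall>j<l. \<exists>s. continuous_map (subtopology ?P (V j)) (mapping_space (wedge_intervals n) X) s
              \<and> (\<forall>b\<in>V j. wedge_evaluation n (s b) = b)"
  have "homotopic_with (\<lambda>_. True) (subtopology ?P (V j)) Y
      (f \<circ> (\<lambda>x. x i)) (f \<circ> (\<lambda>x. x (Suc i)))" if j: "j < l" and i: "Suc i < n" for i j
  proof -
    from s j obtain \<sigma> where \<sigma>:
      "continuous_map (subtopology ?P (V j)) (mapping_space (wedge_intervals n) X) \<sigma>"
      "\<And>x. x \<in> V j \<Longrightarrow> wedge_evaluation n (\<sigma> x) = x"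
      by blast
    have base: "homotopic_with (\<lambda>_. True) (subtopology ?P (V j)) X (\<lambda>x. x k) (\<lambda>x. \<sigma> x (0, 0))"
      if "k < n" for k
      using \<sigma> that by (intro homotopic_projection_base_point) auto
    \<comment> \<open>Follow the homotopy from the \<open>i\<close>-th projection to the base point
      map, then the one for \<open>Suc i\<close> in reverse.\<close>
    have "homotopic_with (\<lambda>_. True) (subtopology ?P (V j)) X (\<lambda>x. x i) (\<lambda>x. x (Suc i))"
      using base [of i] base [of "Suc i"] i
      by (meson Suc_lessD homotopic_with_symD homotopic_with_trans)
    then show ?thesis
      using f by (rule homotopic_with_compose_continuous_map_left) simp
  qed
  then show "\<exists>l'. enat l = enat l' \<and> 0 < l' \<and>
      (\<exists>U. (\<forall>j<l'. openin ?P (U j)) \<and> (\<Union>j<l'. U j) = topspace ?P \<and>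
        (\<forall>j<l'. \<forall>i. Suc i < n \<longrightarrow> homotopic_with (\<lambda>_. True) (subtopology ?P (U j)) Y
            (f \<circ> (\<lambda>x. x i)) (f \<circ> (\<lambda>x. x (Suc i)))))"
    using l V by blast
qed

text \<open>This settles \<open>n = 1\<close>, where \<open>TC_map\<close> is 1 by convention. Every
  admissible \<open>l\<close> is positive, and an empty set of such \<open>l\<close> has infimum
  \<open>\<infinity>\<close>.\<close>

lemma one_le_secat: "1 \<le> secat A B g"
  unfolding secat_def
  by (rule Inf_greatest) (auto simp: one_enat_def)

theorem proposition3p15:
  fixes n :: nat and X :: "'a topology" and Y :: "'b topology"
    and f :: "'a \<Rightarrow> nat \<Rightarrow> 'b"
  assumes "n \<ge> 1"
    and "path_connected_space X" and "path_connected_space Y"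
    and "fibration X (power_topology Y n) f"
    and "f ` topspace X = topspace (power_topology Y n)"
  shows "TC_map n X Y f \<le> TC n X"
proof (cases "n = 1")
  case True
  then show ?thesis
    by (simp add: TC_map_def TC_def one_le_secat)
next
  case False
  have "continuous_map X (power_topology Y n) f"
    using assms(4) by (simp add: fibration_def)
  then show ?thesis
    using False by (simp add: TC_map_def homotopic_distance_projections_le_TC)
qed

end
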